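(* Let $K$ be a field, $\lambda\in K$. Let $(C,\Delta,\varepsilon,\alpha_C,\beta_C,\psi_C,\omega_C,\sigma)$ be an anti-coquasitriangular counitary $\lambda$-infBH-bialgebra and let $(M,\widetilde\varphi,\psi_M,\omega_M)$ be a right $(C,\Delta,\psi_C,\omega_C)$-comodule, with $\omega_M$ invertible and $\widetilde\varphi(m)=m_{(0)}\otimes m_{(1)}$. Let $\alpha_M,\beta_M:M\to M$ be linear maps such that $\alpha_M\omega_M=\omega_M\alpha_M$ and $\widetilde\varphi\alpha_M=(\alpha_M\otimes\alpha_C)\widetilde\varphi$. Then $(M,\widetilde\nu,\widetilde\varphi,\alpha_M,\beta_M,\psi_M,\omega_M)$ is a right $\lambda$-infBH-Hopf module over $C$ (with multiplication $\widetilde\mu_\sigma$), where the action $\widetilde\nu:M\otimes C\to M$ is given by $$\widetilde\nu(m\otimes c)=\alpha_M\omega_M^{-1}(m_{(0)})\,\sigma(m_{(1)},\psi_C(c)),\qquad c\in C,\ m\in M.$$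
   Context: Everything is over the field $K$; $\Delta(c)=c_1\otimes c_2$. BiHom-coassociative coalgebra $(C,\Delta,\psi,\omega)$: $\psi\omega=\omega\psi$, $(\psi\otimes\psi)\Delta=\Delta\psi$, $(\omega\otimes\omega)\Delta=\Delta\omega$, $(\Delta\otimes\psi)\Delta=(\omega\otimes\Delta)\Delta$. Counitary: there is linear $\varepsilon:C\to K$ with $\varepsilon\psi=\varepsilon\omega=\varepsilon$, $(\mathrm{id}\otimes\varepsilon)\Delta=\omega$, $(\varepsilon\otimes\mathrm{id})\Delta=\psi$. Anti-coquasitriangular counitary $\lambda$-infBH-bialgebra ($\lambda$-infinitesimal BiHom-bialgebra) $(C,\Delta,\varepsilon,\alpha,\beta,\psi,\omega,\sigma)$: $(C,\Delta,\varepsilon,\psi,\omega)$ is a counitary BiHom-coassociative coalgebra with $\psi,\omega$ bijective; $\alpha,\beta:C\to C$ are linear, each commutes with $\psi$ and with $\omega$, and $\varepsilon\alpha=\varepsilon\beta=\varepsilon$; $\sigma\in(C\otimes C)^*$ satisfies $\sigma(f(c),f(d))=\sigma(c,d)$ for $f\in\{\alpha,\beta,\psi,\omega\}$, and for all $c,d,e\in C$ $$\sigma(\alpha(c_1),\beta\omega(e))\sigma(c_2,\psi(d))-\sigma(\omega(c),d_1)\sigma(d_2,\psi(e))+\sigma(\omega(d),e_1)\sigma(\alpha\psi(c),\beta(e_2))=-\lambda\,\sigma(\alpha(c),\beta(e))\varepsilon(d).$$ Its multiplication is $cd=\widetilde\mu_\sigma(c\otimes d)=\alpha\omega^{-1}(c_1)\sigma(c_2,\psi(d))-\sigma(\omega(c),d_1)\beta\psi^{-1}(d_2)-\lambda\,\varepsilon(c)\beta(d)$,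 and $\psi,\omega$ are required to be multiplicative for it. Right comodule $(M,\varphi,\psi_M,\omega_M)$, $\varphi:M\to M\otimes C$: $\psi_M\omega_M=\omega_M\psi_M$; $(g_M\otimes g_C)\varphi=\varphi g_M$ for $g\in\{\psi,\omega\}$; $(\omega_M\otimes\Delta)\varphi=(\varphi\otimes\psi_C)\varphi$. Right module $(M,\triangleleft,\alpha_M,\beta_M)$ over $(C,\mu,\alpha_C,\beta_C)$: $\alpha_M\beta_M=\beta_M\alpha_M$; $f_M(m\triangleleft c)=f_M(m)\triangleleft f_C(c)$ for $f\in\{\alpha,\beta\}$; $\alpha_M(m)\triangleleft(cd)=(m\triangleleft c)\triangleleft\beta_C(d)$. Right $\lambda$-infBH-Hopf module $(M,\triangleleft,\varphi,\alpha_M,\beta_M,\psi_M,\omega_M)$: a right module and a right comodule, any two of $\alpha_M,\beta_M,\psi_M,\omega_M$ commute, and, with $\varphi(m)=m_{(0)}\otimes m_{(1)}$, $\varphi(m\triangleleft c)=\omega_M(m)\triangleleft c_1\otimes\beta_C(c_2)+\alpha_M(m_{(0)})\otimes m_{(1)}\psi_C(c)+\lambda\,\alpha_M\omega_M(m)\otimes\beta_C\psi_C(c)$. Here $m\triangleleft c=\widetilde\nu(m\otimes c)$.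
   Formalization: The formal theorem additionally assumes that α_M commutes with ψ_M and β_M, that β_M commutes with ψ_M and ω_M, that φ̃β_M=(β_M⊗β_C)φ̃, and, when λ≠0, that the comodule is counitary: (id⊗ε)φ̃=ω_M. Without these the claim is false. *)

theory Defs
  imports Complex_Main "HOL-Library.Poly_Mapping"
begin

section \<open>Formal linear combinations\<close>

text \<open>\<open>'x \<Rightarrow>\<^sub>0 'k\<close> is the free vector space over the field \<open>'k\<close> on the set of all elements
  of \<open>'x\<close>.\<close>

definition formal_scale :: "'k::field \<Rightarrow> ('x \<Rightarrow>\<^sub>0 'k) \<Rightarrow> ('x \<Rightarrow>\<^sub>0 'k)" where
  "formal_scale k t = Poly_Mapping.map ((*) k) t"

abbreviation pure :: "'x \<Rightarrow> ('x \<Rightarrow>\<^sub>0 'k::field)" where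
  "pure x \<equiv> Poly_Mapping.single x 1"

definition linear_extension ::
    "('k::field \<Rightarrow> 'b::ab_group_add \<Rightarrow> 'b) \<Rightarrow> ('x \<Rightarrow> 'b) \<Rightarrow> ('x \<Rightarrow>\<^sub>0 'k) \<Rightarrow> 'b" where
  "linear_extension s f t = (\<Sum>x\<in>Poly_Mapping.keys t. s (Poly_Mapping.lookup t x) (f x))"

section \<open>Tensor products\<close>

text \<open>\<open>V \<otimes> W\<close> is the quotient of the free vector space on \<open>V \<times> W\<close> by the span of the usual
  bilinearity relations; \<open>U \<otimes> V \<otimes> W\<close> is the analogous quotient of the free space on
  \<open>U \<times> V \<times> W\<close> by the trilinearity relations, so that no associativity isomorphisms are
  needed. The scalar multiplications of the factors are passed explicitly. Elements of a
  quotient are cosets.\<close>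

definition tensor_relations ::
    "('k::field \<Rightarrow> 'v::ab_group_add \<Rightarrow> 'v) \<Rightarrow> ('k \<Rightarrow> 'w::ab_group_add \<Rightarrow> 'w)
     \<Rightarrow> ('v \<times> 'w \<Rightarrow>\<^sub>0 'k) set" where
  "tensor_relations sV sW = module.span formal_scale
    ({pure (v + v', w) - pure (v, w) - pure (v', w) | v v' w. True}
     \<union> {pure (v, w + w') - pure (v, w) - pure (v, w') | v w w'. True}
     \<union> {pure (sV k v, w) - formal_scale k (pure (v, w)) | k v w. True}
     \<union> {pure (v, sW k w) - formal_scale k (pure (v, w)) | k v w. True})"

definition tensor3_relations ::
    "('k::field \<Rightarrow> 'u::ab_group_add \<Rightarrow> 'u) \<Rightarrow> ('k \<Rightarrow> 'v::ab_group_add \<Rightarrow> 'v)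
     \<Rightarrow> ('k \<Rightarrow> 'w::ab_group_add \<Rightarrow> 'w) \<Rightarrow> ('u \<times> 'v \<times> 'w \<Rightarrow>\<^sub>0 'k) set" where
  "tensor3_relations sU sV sW = module.span formal_scale
    ({pure (u + u', v, w) - pure (u, v, w) - pure (u', v, w) | u u' v w. True}
     \<union> {pure (u, v + v', w) - pure (u, v, w) - pure (u, v', w) | u v v' w. True}
     \<union> {pure (u, v, w + w') - pure (u, v, w) - pure (u, v, w') | u v w w'. True}
     \<union> {pure (sU k u, v, w) - formal_scale k (pure (u, v, w)) | k u v w. True}
     \<union> {pure (u, sV k v, w) - formal_scale k (pure (u, v, w)) | k u v w. True}
     \<union> {pure (u, v, sW k w) - formal_scale k (pure (u, v, w)) | k u v w. True})"

definition coset :: "('x \<Rightarrow>\<^sub>0 'k::field) set \<Rightarrow> ('x \<Rightarrow>\<^sub>0 'k) \<Rightarrow> ('x \<Rightarrow>\<^sub>0 'k) set" where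
  "coset N t = {u. u - t \<in> N}"

definition representative :: "('x \<Rightarrow>\<^sub>0 'k::field) set \<Rightarrow> ('x \<Rightarrow>\<^sub>0 'k)" where
  "representative A = (SOME t. t \<in> A)"

definition quotient_add ::
    "('x \<Rightarrow>\<^sub>0 'k::field) set \<Rightarrow> ('x \<Rightarrow>\<^sub>0 'k) set \<Rightarrow> ('x \<Rightarrow>\<^sub>0 'k) set \<Rightarrow> ('x \<Rightarrow>\<^sub>0 'k) set" where
  "quotient_add N A B = coset N (representative A + representative B)"

definition quotient_scale ::
    "('x \<Rightarrow>\<^sub>0 'k::field) set \<Rightarrow> 'k \<Rightarrow> ('x \<Rightarrow>\<^sub>0 'k) set \<Rightarrow> ('x \<Rightarrow>\<^sub>0 'k) set" where
  "quotient_scale N k A = coset N (formal_scale k (representative A))"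

text \<open>Linear maps from a vector space into the quotient by \<open>N\<close>.\<close>

definition linear_into_quotient ::
    "('k::field \<Rightarrow> 'v::ab_group_add \<Rightarrow> 'v) \<Rightarrow> ('x \<Rightarrow>\<^sub>0 'k) set \<Rightarrow> ('v \<Rightarrow> ('x \<Rightarrow>\<^sub>0 'k) set) \<Rightarrow> bool" where
  "linear_into_quotient s N F \<longleftrightarrow>
     (\<forall>x. F x \<in> range (coset N)) \<and>
     (\<forall>x y. F (x + y) = quotient_add N (F x) (F y)) \<and>
     (\<forall>k x. F (s k x) = quotient_scale N k (F x))"

definition bilinear_map ::
    "('k::field \<Rightarrow> 'v::ab_group_add \<Rightarrow> 'v) \<Rightarrow> ('k \<Rightarrow> 'w::ab_group_add \<Rightarrow> 'w)
     \<Rightarrow> ('k \<Rightarrow> 'b::ab_group_add \<Rightarrow> 'b) \<Rightarrow> ('v \<Rightarrow> 'w \<Rightarrow> 'b) \<Rightarrow> bool" where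
  "bilinear_map sV sW s f \<longleftrightarrow>
     (\<forall>v. Vector_Spaces.linear sW s (f v)) \<and> (\<forall>w. Vector_Spaces.linear sV s (\<lambda>v. f v w))"

text \<open>For bilinear \<open>f\<close>, the linear map on \<open>V \<otimes> W\<close> induced by \<open>f\<close>. In Sweedler notation
  \<open>\<Delta>(c) = c\<^sub>1 \<otimes> c\<^sub>2\<close>, the expression \<open>f(c\<^sub>1, c\<^sub>2)\<close> is \<open>tensor_lift s f (\<Delta> c)\<close>. See
  \<open>tensor_lift_coset\<close> below for independence of the chosen representative.\<close>

definition tensor_lift ::
    "('k::field \<Rightarrow> 'b::ab_group_add \<Rightarrow> 'b) \<Rightarrow> ('v \<Rightarrow> 'w \<Rightarrow> 'b) \<Rightarrow> ('v \<times> 'w \<Rightarrow>\<^sub>0 'k) set \<Rightarrow> 'b" where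
  "tensor_lift s f A = linear_extension s (\<lambda>(v, w). f v w) (representative A)"

definition tensor ::
    "('k::field \<Rightarrow> 'v::ab_group_add \<Rightarrow> 'v) \<Rightarrow> ('k \<Rightarrow> 'w::ab_group_add \<Rightarrow> 'w)
     \<Rightarrow> 'v \<Rightarrow> 'w \<Rightarrow> ('v \<times> 'w \<Rightarrow>\<^sub>0 'k) set" where
  "tensor sV sW v w = coset (tensor_relations sV sW) (pure (v, w))"

text \<open>\<open>f \<otimes> g\<close> as a map into \<open>V \<otimes> W\<close>, where \<open>sV\<close>, \<open>sW\<close> belong to the codomains of \<open>f\<close>, \<open>g\<close>;
  then \<open>F \<otimes> g\<close> for \<open>F\<close> with values in \<open>U \<otimes> V\<close>, and \<open>f \<otimes> G\<close> for \<open>G\<close> with values in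
  \<open>V \<otimes> W\<close>.\<close>

definition tensor_map ::
    "('k::field \<Rightarrow> 'v::ab_group_add \<Rightarrow> 'v) \<Rightarrow> ('k \<Rightarrow> 'w::ab_group_add \<Rightarrow> 'w)
     \<Rightarrow> ('a \<Rightarrow> 'v) \<Rightarrow> ('b \<Rightarrow> 'w) \<Rightarrow> ('a \<times> 'b \<Rightarrow>\<^sub>0 'k) set \<Rightarrow> ('v \<times> 'w \<Rightarrow>\<^sub>0 'k) set" where
  "tensor_map sV sW f g A = coset (tensor_relations sV sW)
     (linear_extension formal_scale (\<lambda>(a, b). pure (f a, g b)) (representative A))"

definition tensor_map_left ::
    "('k::field \<Rightarrow> 'u::ab_group_add \<Rightarrow> 'u) \<Rightarrow> ('k \<Rightarrow> 'v::ab_group_add \<Rightarrow> 'v)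
     \<Rightarrow> ('k \<Rightarrow> 'w::ab_group_add \<Rightarrow> 'w) \<Rightarrow> ('a \<Rightarrow> ('u \<times> 'v \<Rightarrow>\<^sub>0 'k) set) \<Rightarrow> ('b \<Rightarrow> 'w)
     \<Rightarrow> ('a \<times> 'b \<Rightarrow>\<^sub>0 'k) set \<Rightarrow> ('u \<times> 'v \<times> 'w \<Rightarrow>\<^sub>0 'k) set" where
  "tensor_map_left sU sV sW F g A = coset (tensor3_relations sU sV sW)
     (linear_extension formal_scale
       (\<lambda>(a, b). linear_extension formal_scale (\<lambda>(u, v). pure (u, v, g b)) (representative (F a)))
       (representative A))"

definition tensor_map_right ::
    "('k::field \<Rightarrow> 'u::ab_group_add \<Rightarrow> 'u) \<Rightarrow> ('k \<Rightarrow> 'v::ab_group_add \<Rightarrow> 'v)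
     \<Rightarrow> ('k \<Rightarrow> 'w::ab_group_add \<Rightarrow> 'w) \<Rightarrow> ('a \<Rightarrow> 'u) \<Rightarrow> ('b \<Rightarrow> ('v \<times> 'w \<Rightarrow>\<^sub>0 'k) set)
     \<Rightarrow> ('a \<times> 'b \<Rightarrow>\<^sub>0 'k) set \<Rightarrow> ('u \<times> 'v \<times> 'w \<Rightarrow>\<^sub>0 'k) set" where
  "tensor_map_right sU sV sW f G A = coset (tensor3_relations sU sV sW)
     (linear_extension formal_scale
       (\<lambda>(a, b). linear_extension formal_scale (\<lambda>(v, w). pure (f a, v, w)) (representative (G b)))
       (representative A))"

section \<open>Well-definedness\<close>

lemma lookup_formal_scale:
  "Poly_Mapping.lookup (formal_scale k t) x = k * Poly_Mapping.lookup t x"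
  by (simp add: formal_scale_def Poly_Mapping.map.rep_eq when_def)

lemma vector_space_formal_scale: "vector_space formal_scale"
  by unfold_locales
    (auto intro!: poly_mapping_eqI simp: lookup_formal_scale lookup_add algebra_simps)

lemma linear_linear_extension:
  fixes s :: "'k::field \<Rightarrow> 'b::ab_group_add \<Rightarrow> 'b" and f :: "'x \<Rightarrow> 'b"
  assumes "vector_space s"
  shows "Vector_Spaces.linear formal_scale s (linear_extension s f)"
proof -
  interpret vector_space s by (fact assms)
  have eq: "linear_extension s f t = (\<Sum>x\<in>A. s (Poly_Mapping.lookup t x) (f x))"
    if "finite A" "Poly_Mapping.keys t \<subseteq> A" for A and t :: "'x \<Rightarrow>\<^sub>0 'k"
    unfolding linear_extension_def using that
    by (intro sum.mono_neutral_left) (auto simp: in_keys_iff)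
  show ?thesis
  proof (intro Vector_Spaces.linear.intro module_hom.intro module_hom_axioms.intro)
    fix t u :: "'x \<Rightarrow>\<^sub>0 'k" and k
    let ?A = "Poly_Mapping.keys t \<union> Poly_Mapping.keys u"
    have "Poly_Mapping.keys (t + u) \<subseteq> ?A" by (fact Poly_Mapping.keys_add)
    then show "linear_extension s f (t + u) = linear_extension s f t + linear_extension s f u"
      by (simp add: eq[of ?A] lookup_add scale_left_distrib sum.distrib)
    have "Poly_Mapping.keys (formal_scale k t) \<subseteq> Poly_Mapping.keys t"
      by (auto simp: in_keys_iff lookup_formal_scale)
    then show "linear_extension s f (formal_scale k t) = s k (linear_extension s f t)"
      by (simp add: eq[of "Poly_Mapping.keys t"] lookup_formal_scale scale_sum_right)
  qed (use assms vector_space_formal_scale in \<open>auto simp: module_iff_vector_space\<close>)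
qed

lemma linear_extension_pure:
  assumes "vector_space s"
  shows "linear_extension s f (pure x) = f x"
proof -
  interpret vector_space s by (fact assms)
  show ?thesis by (simp add: linear_extension_def)
qed

lemma linear_extension_tensor_relations:
  assumes f: "bilinear_map sV sW s f" and t: "t \<in> tensor_relations sV sW"
  shows "linear_extension s (\<lambda>(v, w). f v w) t = 0"
proof -
  let ?L = "linear_extension s (\<lambda>(v, w). f v w)"
  have lf: "Vector_Spaces.linear sW s (f v)" "Vector_Spaces.linear sV s (\<lambda>v. f v w)" for v w
    using f by (auto simp: bilinear_map_def)
  have vs: "vector_space s" using lf(1) by (auto simp: Vector_Spaces.linear_def)
  interpret F: vector_space formal_scale by (fact vector_space_formal_scale)
  interpret L: Vector_Spaces.linear formal_scale s ?L by (rule linear_linear_extension[OF vs])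
  have add: "f v (w + w') = f v w + f v w'" "f (v + v') w = f v w + f v' w" for v v' w w'
    using module_hom.add lf Vector_Spaces.linear.axioms(3) by blast+
  have sc: "f v (sW k w) = s k (f v w)" "f (sV k v) w = s k (f v w)" for k v w
    using module_hom.scale lf Vector_Spaces.linear.axioms(3) by blast+
  show ?thesis
    using t unfolding tensor_relations_def
  proof (induction rule: F.span_induct_alt)
    case base
    show ?case by (fact L.zero)
  next
    case (step k x y)
    have "?L x = 0"
      using step(1) by (auto simp: L.diff L.scale linear_extension_pure[OF vs] add sc)
    then show ?case using step by (simp add: L.add L.scale)
  qed
qed

lemma representative_coset_diff:
  assumes "0 \<in> N"
  shows "representative (coset N t) - t \<in> N"
proof -
  have "t \<in> coset N t" using assms by (simp add: coset_def)
  then have "representative (coset N t) \<in> coset N t"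
    unfolding representative_def by (rule someI)
  then show ?thesis by (simp add: coset_def)
qed

lemma tensor_lift_coset:
  assumes f: "bilinear_map sV sW s f"
  shows "tensor_lift s f (coset (tensor_relations sV sW) t) = linear_extension s (\<lambda>(v, w). f v w) t"
proof -
  let ?r = "representative (coset (tensor_relations sV sW) t)"
  have "Vector_Spaces.linear sW s (f v)" for v using f by (auto simp: bilinear_map_def)
  then have vs: "vector_space s" by (auto simp: Vector_Spaces.linear_def)
  interpret F: vector_space formal_scale by (fact vector_space_formal_scale)
  interpret L: Vector_Spaces.linear formal_scale s "linear_extension s (\<lambda>(v, w). f v w)"
    by (rule linear_linear_extension[OF vs])
  have "?r - t \<in> tensor_relations sV sW"
    by (rule representative_coset_diff) (simp add: tensor_relations_def F.span_zero)
  from linear_extension_tensor_relations[OF f this]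
  show ?thesis by (simp add: tensor_lift_def L.diff)
qed

lemma tensor_lift_tensor:
  assumes "bilinear_map sV sW s f"
  shows "tensor_lift s f (tensor sV sW v w) = f v w"
proof -
  have "Vector_Spaces.linear sW s (f v)" using assms by (auto simp: bilinear_map_def)
  then have vs: "vector_space s" by (auto simp: Vector_Spaces.linear_def)
  show ?thesis by (simp add: tensor_def tensor_lift_coset[OF assms] linear_extension_pure[OF vs])
qed

section \<open>BiHom-structures\<close>

locale bihom_coassociative_coalgebra =
  fixes s :: "'k::field \<Rightarrow> 'c::ab_group_add \<Rightarrow> 'c"
    and \<Delta> :: "'c \<Rightarrow> ('c \<times> 'c \<Rightarrow>\<^sub>0 'k) set"
    and \<psi> \<omega> :: "'c \<Rightarrow> 'c"
  assumes vector_space_scale: "vector_space s"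
    and linear_comult: "linear_into_quotient s (tensor_relations s s) \<Delta>"
    and linear_psi: "Vector_Spaces.linear s s \<psi>"
    and linear_omega: "Vector_Spaces.linear s s \<omega>"
    and psi_omega: "\<psi> \<circ> \<omega> = \<omega> \<circ> \<psi>"
    and comult_psi: "tensor_map s s \<psi> \<psi> \<circ> \<Delta> = \<Delta> \<circ> \<psi>"
    and comult_omega: "tensor_map s s \<omega> \<omega> \<circ> \<Delta> = \<Delta> \<circ> \<omega>"
    and coassociative: "tensor_map_left s s s \<Delta> \<psi> \<circ> \<Delta> = tensor_map_right s s s \<omega> \<Delta> \<circ> \<Delta>"

locale counitary_bihom_coalgebra = bihom_coassociative_coalgebra s \<Delta> \<psi> \<omega>
  for s :: "'k::field \<Rightarrow> 'c::ab_group_add \<Rightarrow> 'c"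
    and \<Delta> :: "'c \<Rightarrow> ('c \<times> 'c \<Rightarrow>\<^sub>0 'k) set"
    and \<epsilon> :: "'c \<Rightarrow> 'k"
    and \<psi> \<omega> :: "'c \<Rightarrow> 'c" +
  assumes linear_counit: "Vector_Spaces.linear s (*) \<epsilon>"
    and counit_psi: "\<epsilon> \<circ> \<psi> = \<epsilon>"
    and counit_omega: "\<epsilon> \<circ> \<omega> = \<epsilon>"
    and counit_right: "tensor_lift s (\<lambda>c1 c2. s (\<epsilon> c2) c1) (\<Delta> c) = \<omega> c"
    and counit_left: "tensor_lift s (\<lambda>c1 c2. s (\<epsilon> c1) c2) (\<Delta> c) = \<psi> c"

definition sigma_mult ::
    "('k::field \<Rightarrow> 'c::ab_group_add \<Rightarrow> 'c) \<Rightarrow> 'k \<Rightarrow> ('c \<Rightarrow> ('c \<times> 'c \<Rightarrow>\<^sub>0 'k) set) \<Rightarrow> ('c \<Rightarrow> 'k)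
     \<Rightarrow> ('c \<Rightarrow> 'c) \<Rightarrow> ('c \<Rightarrow> 'c) \<Rightarrow> ('c \<Rightarrow> 'c) \<Rightarrow> ('c \<Rightarrow> 'c) \<Rightarrow> ('c \<Rightarrow> 'c \<Rightarrow> 'k)
     \<Rightarrow> 'c \<Rightarrow> 'c \<Rightarrow> 'c" where
  "sigma_mult s l \<Delta> \<epsilon> \<alpha> \<beta> \<psi> \<omega> \<sigma> c d =
     tensor_lift s (\<lambda>c1 c2. s (\<sigma> c2 (\<psi> d)) (\<alpha> (inv \<omega> c1))) (\<Delta> c)
     - tensor_lift s (\<lambda>d1 d2. s (\<sigma> (\<omega> c) d1) (\<beta> (inv \<psi> d2))) (\<Delta> d)
     - s (l * \<epsilon> c) (\<beta> d)"

text \<open>The linear form \<open>\<sigma>\<close> on \<open>C \<otimes> C\<close> is given as the corresponding bilinear form on \<open>C\<close>.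
  The weight is called \<open>l\<close>.\<close>

locale anti_coquasitriangular_infBH_bialgebra = counitary_bihom_coalgebra s \<Delta> \<epsilon> \<psi> \<omega>
  for s :: "'k::field \<Rightarrow> 'c::ab_group_add \<Rightarrow> 'c"
    and l :: 'k
    and \<Delta> :: "'c \<Rightarrow> ('c \<times> 'c \<Rightarrow>\<^sub>0 'k) set"
    and \<epsilon> :: "'c \<Rightarrow> 'k"
    and \<alpha> \<beta> \<psi> \<omega> :: "'c \<Rightarrow> 'c"
    and \<sigma> :: "'c \<Rightarrow> 'c \<Rightarrow> 'k" +
  assumes bij_psi: "bij \<psi>" and bij_omega: "bij \<omega>"
    and linear_alpha: "Vector_Spaces.linear s s \<alpha>"
    and linear_beta: "Vector_Spaces.linear s s \<beta>"
    and alpha_psi: "\<alpha> \<circ> \<psi> = \<psi> \<circ> \<alpha>"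
    and alpha_omega: "\<alpha> \<circ> \<omega> = \<omega> \<circ> \<alpha>"
    and beta_psi: "\<beta> \<circ> \<psi> = \<psi> \<circ> \<beta>"
    and beta_omega: "\<beta> \<circ> \<omega> = \<omega> \<circ> \<beta>"
    and counit_alpha: "\<epsilon> \<circ> \<alpha> = \<epsilon>"
    and counit_beta: "\<epsilon> \<circ> \<beta> = \<epsilon>"
    and bilinear_sigma: "bilinear_map s s (*) \<sigma>"
    and sigma_invariant: "f \<in> {\<alpha>, \<beta>, \<psi>, \<omega>} \<Longrightarrow> \<sigma> (f c) (f d) = \<sigma> c d"
    and anti_coquasitriangular:
      "tensor_lift (*) (\<lambda>c1 c2. \<sigma> (\<alpha> c1) (\<beta> (\<omega> e)) * \<sigma> c2 (\<psi> d)) (\<Delta> c)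
       - tensor_lift (*) (\<lambda>d1 d2. \<sigma> (\<omega> c) d1 * \<sigma> d2 (\<psi> e)) (\<Delta> d)
       + tensor_lift (*) (\<lambda>e1 e2. \<sigma> (\<omega> d) e1 * \<sigma> (\<alpha> (\<psi> c)) (\<beta> e2)) (\<Delta> e)
       = - l * \<sigma> (\<alpha> c) (\<beta> e) * \<epsilon> d"
    and psi_mult: "\<psi> (sigma_mult s l \<Delta> \<epsilon> \<alpha> \<beta> \<psi> \<omega> \<sigma> c d)
                   = sigma_mult s l \<Delta> \<epsilon> \<alpha> \<beta> \<psi> \<omega> \<sigma> (\<psi> c) (\<psi> d)"
    and omega_mult: "\<omega> (sigma_mult s l \<Delta> \<epsilon> \<alpha> \<beta> \<psi> \<omega> \<sigma> c d)
                   = sigma_mult s l \<Delta> \<epsilon> \<alpha> \<beta> \<psi> \<omega> \<sigma> (\<omega> c) (\<omega> d)"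

text \<open>In the next three locales \<open>s\<close> is the scalar multiplication of the module \<open>M\<close>, and
  \<open>sC\<close>, \<open>\<Delta>\<close>, \<open>mult\<close>, \<open>\<alpha>\<close>, \<open>\<beta>\<close>, \<open>\<psi>\<close>, \<open>\<omega>\<close> are the data of \<open>C\<close>.\<close>

locale right_bihom_comodule =
  fixes sC :: "'k::field \<Rightarrow> 'c::ab_group_add \<Rightarrow> 'c"
    and \<Delta> :: "'c \<Rightarrow> ('c \<times> 'c \<Rightarrow>\<^sub>0 'k) set"
    and \<psi> \<omega> :: "'c \<Rightarrow> 'c"
    and s :: "'k \<Rightarrow> 'm::ab_group_add \<Rightarrow> 'm"
    and \<phi> :: "'m \<Rightarrow> ('m \<times> 'c \<Rightarrow>\<^sub>0 'k) set"
    and \<psi>\<^sub>M \<omega>\<^sub>M :: "'m \<Rightarrow> 'm"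
  assumes vector_space_scale: "vector_space s"
    and linear_coaction: "linear_into_quotient s (tensor_relations s sC) \<phi>"
    and linear_psi: "Vector_Spaces.linear s s \<psi>\<^sub>M"
    and linear_omega: "Vector_Spaces.linear s s \<omega>\<^sub>M"
    and psi_omega: "\<psi>\<^sub>M \<circ> \<omega>\<^sub>M = \<omega>\<^sub>M \<circ> \<psi>\<^sub>M"
    and coaction_psi: "tensor_map s sC \<psi>\<^sub>M \<psi> \<circ> \<phi> = \<phi> \<circ> \<psi>\<^sub>M"
    and coaction_omega: "tensor_map s sC \<omega>\<^sub>M \<omega> \<circ> \<phi> = \<phi> \<circ> \<omega>\<^sub>M"
    and coaction_coassociative:
      "tensor_map_right s sC sC \<omega>\<^sub>M \<Delta> \<circ> \<phi> = tensor_map_left s sC sC \<phi> \<psi> \<circ> \<phi>"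

text \<open>The linear action \<open>M \<otimes> C \<rightarrow> M\<close> is given as the corresponding bilinear map.\<close>

locale right_bihom_module =
  fixes sC :: "'k::field \<Rightarrow> 'c::ab_group_add \<Rightarrow> 'c"
    and mult :: "'c \<Rightarrow> 'c \<Rightarrow> 'c"
    and \<alpha> \<beta> :: "'c \<Rightarrow> 'c"
    and s :: "'k \<Rightarrow> 'm::ab_group_add \<Rightarrow> 'm"
    and act :: "'m \<Rightarrow> 'c \<Rightarrow> 'm" (infixl "\<triangleleft>" 70)
    and \<alpha>\<^sub>M \<beta>\<^sub>M :: "'m \<Rightarrow> 'm"
  assumes vector_space_scale: "vector_space s"
    and bilinear_act: "bilinear_map s sC s act"
    and linear_alpha: "Vector_Spaces.linear s s \<alpha>\<^sub>M"
    and linear_beta: "Vector_Spaces.linear s s \<beta>\<^sub>M"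
    and alpha_beta: "\<alpha>\<^sub>M \<circ> \<beta>\<^sub>M = \<beta>\<^sub>M \<circ> \<alpha>\<^sub>M"
    and alpha_act: "\<alpha>\<^sub>M (m \<triangleleft> c) = \<alpha>\<^sub>M m \<triangleleft> \<alpha> c"
    and beta_act: "\<beta>\<^sub>M (m \<triangleleft> c) = \<beta>\<^sub>M m \<triangleleft> \<beta> c"
    and act_mult: "\<alpha>\<^sub>M m \<triangleleft> mult c d = (m \<triangleleft> c) \<triangleleft> \<beta> d"

locale right_infBH_hopf_module =
  module: right_bihom_module sC mult \<alpha> \<beta> s act \<alpha>\<^sub>M \<beta>\<^sub>M +
  comodule: right_bihom_comodule sC \<Delta> \<psi> \<omega> s \<phi> \<psi>\<^sub>M \<omega>\<^sub>M
  for sC :: "'k::field \<Rightarrow> 'c::ab_group_add \<Rightarrow> 'c"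
    and l :: 'k
    and mult :: "'c \<Rightarrow> 'c \<Rightarrow> 'c"
    and \<Delta> :: "'c \<Rightarrow> ('c \<times> 'c \<Rightarrow>\<^sub>0 'k) set"
    and \<alpha> \<beta> \<psi> \<omega> :: "'c \<Rightarrow> 'c"
    and s :: "'k \<Rightarrow> 'm::ab_group_add \<Rightarrow> 'm"
    and act :: "'m \<Rightarrow> 'c \<Rightarrow> 'm" (infixl "\<triangleleft>" 70)
    and \<phi> :: "'m \<Rightarrow> ('m \<times> 'c \<Rightarrow>\<^sub>0 'k) set"
    and \<alpha>\<^sub>M \<beta>\<^sub>M \<psi>\<^sub>M \<omega>\<^sub>M :: "'m \<Rightarrow> 'm" +
  assumes commute: "f \<in> {\<alpha>\<^sub>M, \<beta>\<^sub>M, \<psi>\<^sub>M, \<omega>\<^sub>M} \<Longrightarrow> g \<in> {\<alpha>\<^sub>M, \<beta>\<^sub>M, \<psi>\<^sub>M, \<omega>\<^sub>M} \<Longrightarrow> f \<circ> g = g \<circ> f"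
    and coaction_act:
      "\<phi> (m \<triangleleft> c) =
        quotient_add (tensor_relations s sC)
          (quotient_add (tensor_relations s sC)
            (tensor_map s sC (\<lambda>c1. \<omega>\<^sub>M m \<triangleleft> c1) \<beta> (\<Delta> c))
            (tensor_map s sC \<alpha>\<^sub>M (\<lambda>m1. mult m1 (\<psi> c)) (\<phi> m)))
          (quotient_scale (tensor_relations s sC) l (tensor s sC (\<alpha>\<^sub>M (\<omega>\<^sub>M m)) (\<beta> (\<psi> c))))"

end

theory Submission
  imports Defs
begin

text \<open>In Sweedler notation both sides of the module law equal
  \<open>\<alpha>\<^sup>2 \<omega>\<^sup>-\<^sup>1(m\<^sub>0) \<sigma>(\<alpha>(m\<^sub>1\<^sub>1), \<omega>\<psi>\<beta>(d)) \<sigma>(m\<^sub>1\<^sub>2, \<psi>\<^sup>2(c))\<close>: one by coassociativity of the coaction, the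
  other by the anti-coquasitriangular identity for \<open>m\<^sub>1, \<psi>(c), \<psi>(d)\<close>. In the Hopf compatibility
  the first term of \<open>m\<^sub>1 \<psi>(c)\<close> yields \<open>\<phi>(m \<triangleleft> c)\<close>, the second one cancels
  \<open>\<omega>(m) \<triangleleft> c\<^sub>1 \<otimes> \<beta>(c\<^sub>2)\<close>, and the last one cancels the \<open>\<lambda>\<close>-term because the comodule is counitary.
  Over a field bilinear forms separate the elements of a tensor product, so an identity of cosets
  reduces to identities between scalars \<open>f(m\<^sub>0, m\<^sub>1)\<close>, that is, between finite sums.\<close>

section \<open>Calculus of lifted bilinear maps\<close>

lemma vector_space_mult: "vector_space ((*) :: 'k::field \<Rightarrow> 'k \<Rightarrow> 'k)"
  by unfold_locales (simp_all add: algebra_simps)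

lemma linear_inv:
  assumes f: "Vector_Spaces.linear s s' f" and "bij f"
  shows "Vector_Spaces.linear s' s (inv f)"
proof -
  have inj: "inj f" and surj: "surj f" using \<open>bij f\<close> by (auto simp: bij_def)
  have "inv f (x + y) = inv f x + inv f y" for x y
    using f by (intro inv_f_eq[OF inj]) (simp add: Vector_Spaces.linear_iff surj_f_inv_f[OF surj])
  moreover have "inv f (s' k x) = s k (inv f x)" for k x
    using f by (intro inv_f_eq[OF inj]) (simp add: Vector_Spaces.linear_iff surj_f_inv_f[OF surj])
  ultimately show ?thesis using f by (simp add: Vector_Spaces.linear_iff)
qed

lemma linear_linear_extension_apply:
  assumes "Vector_Spaces.linear s s' L"
  shows "L (linear_extension s f t) = linear_extension s' (\<lambda>x. L (f x)) t"
proof -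
  interpret L: Vector_Spaces.linear s s' L by (fact assms)
  show ?thesis by (simp add: linear_extension_def L.sum L.scale)
qed

text \<open>Expands a formal combination in the basis of pure vectors, so that a linear functional
  can be recovered from its values on them.\<close>

lemma linear_extension_formal_pure: "linear_extension formal_scale pure t = t"
proof (rule poly_mapping_eqI)
  fix x
  have "Poly_Mapping.lookup (linear_extension formal_scale pure t) x =
      (\<Sum>y\<in>Poly_Mapping.keys t. if y = x then Poly_Mapping.lookup t y else 0)"
    unfolding linear_extension_def lookup_sum
    by (rule sum.cong) (auto simp: lookup_formal_scale lookup_single when_def)
  then show "Poly_Mapping.lookup (linear_extension formal_scale pure t) x = Poly_Mapping.lookup t x"
    by (simp add: in_keys_iff)
qed

lemma linear_extension_linear_extension:
  assumes "vector_space s"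
  shows "linear_extension s f (linear_extension formal_scale g t) =
    linear_extension s (\<lambda>x. linear_extension s f (g x)) t"
  by (rule linear_linear_extension_apply[OF linear_linear_extension[OF assms]])

text \<open>For a fixed coset the lift is a finite sum over one chosen representative. Additivity,
  scaling and exchange of sums therefore hold term by term for any function \<open>f\<close>;
  bilinearity matters only when the coset itself is rewritten and its representative may
  change.\<close>

lemma tensor_lift_sum:
  "tensor_lift s f A = (\<Sum>x\<in>Poly_Mapping.keys (representative A).
     s (Poly_Mapping.lookup (representative A) x) (f (fst x) (snd x)))"
  by (simp add: tensor_lift_def linear_extension_def case_prod_beta)

lemma linear_tensor_lift:
  assumes "Vector_Spaces.linear s s' L"
  shows "L (tensor_lift s f A) = tensor_lift s' (\<lambda>a b. L (f a b)) A"
  unfolding tensor_lift_def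
  by (subst linear_linear_extension_apply[OF assms]) (simp add: case_prod_beta')

section \<open>Rules for sums over Sweedler components\<close>

context vector_space
begin

lemma tensor_lift_add:
  "tensor_lift scale (\<lambda>a b. f a b + g a b) A = tensor_lift scale f A + tensor_lift scale g A"
  by (simp add: tensor_lift_sum scale_right_distrib sum.distrib)

lemma tensor_lift_diff:
  "tensor_lift scale (\<lambda>a b. f a b - g a b) A = tensor_lift scale f A - tensor_lift scale g A"
  by (simp add: tensor_lift_sum scale_right_diff_distrib sum_subtractf)

lemma tensor_lift_scale:
  "tensor_lift scale (\<lambda>a b. scale k (f a b)) A = scale k (tensor_lift scale f A)"
  by (simp add: tensor_lift_sum scale_sum_right mult.commute)

lemma tensor_lift_scale_left:
  "tensor_lift scale (\<lambda>a b. scale (f a b) x) A = scale (tensor_lift (*) f A) x"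
  by (simp add: tensor_lift_sum scale_sum_left)

lemma tensor_lift_swap:
  "tensor_lift scale (\<lambda>a b. tensor_lift scale (\<lambda>c d. f a b c d) B) A =
   tensor_lift scale (\<lambda>c d. tensor_lift scale (\<lambda>a b. f a b c d) A) B"
  unfolding tensor_lift_sum scale_sum_right
  by (subst sum.swap) (simp add: mult.commute)

lemma tensor_lift_quotient_add:
  assumes "bilinear_map sV sW scale f"
  shows "tensor_lift scale f (quotient_add (tensor_relations sV sW) A B) =
    tensor_lift scale f A + tensor_lift scale f B"
proof -
  interpret L: Vector_Spaces.linear formal_scale scale "linear_extension scale (\<lambda>(v, w). f v w)"
    by (rule linear_linear_extension[OF vector_space_axioms])
  show ?thesis
    \<comment> \<open>The outer coset is evaluated while \<open>tensor_lift\<close> is still folded,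
      so that independence of the representative applies; only afterwards are the lifts of
      \<open>A\<close> and \<open>B\<close> unfolded.\<close>
    by (simp add: quotient_add_def tensor_lift_coset[OF assms] L.add) (simp add: tensor_lift_def)
qed

lemma tensor_lift_quotient_scale:
  assumes "bilinear_map sV sW scale f"
  shows "tensor_lift scale f (quotient_scale (tensor_relations sV sW) k A) =
    scale k (tensor_lift scale f A)"
proof -
  interpret L: Vector_Spaces.linear formal_scale scale "linear_extension scale (\<lambda>(v, w). f v w)"
    by (rule linear_linear_extension[OF vector_space_axioms])
  show ?thesis
    by (simp add: quotient_scale_def tensor_lift_coset[OF assms] L.scale) (simp add: tensor_lift_def)
qed

text \<open>Both sides read off the same representative of \<open>A\<close>, and bilinearity of
  \<open>h\<close> evaluates the outer coset. Hence \<open>f\<close> and \<open>g\<close> may be any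
  functions, for instance the product with its second argument fixed.\<close>

lemma tensor_lift_tensor_map:
  assumes "bilinear_map sV sW scale h"
  shows "tensor_lift scale h (tensor_map sV sW f g A) = tensor_lift scale (\<lambda>a b. h (f a) (g b)) A"
  unfolding tensor_map_def tensor_lift_coset[OF assms]
  by (subst linear_extension_linear_extension[OF vector_space_axioms])
    (simp add: tensor_lift_def case_prod_beta' linear_extension_pure[OF vector_space_axioms])

text \<open>Makes the lift after a coaction a linear map, which can then be moved inside another
  lift.\<close>

lemma linear_tensor_lift_into_quotient:
  assumes "vector_space sV" "linear_into_quotient sV (tensor_relations sU sW) F"
    and "bilinear_map sU sW scale f"
  shows "Vector_Spaces.linear sV scale (\<lambda>x. tensor_lift scale f (F x))"
  using assms(1,2) vector_space_axioms
  by (simp add: Vector_Spaces.linear_iff linear_into_quotient_def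
      tensor_lift_quotient_add[OF assms(3)] tensor_lift_quotient_scale[OF assms(3)])

end

lemma bilinear_mapI:
  assumes "vector_space sV" "vector_space sW" "vector_space s"
    and "\<And>v v' w. f (v + v') w = f v w + f v' w" "\<And>k v w. f (sV k v) w = s k (f v w)"
    and "\<And>v w w'. f v (w + w') = f v w + f v w'" "\<And>k v w. f v (sW k w) = s k (f v w)"
  shows "bilinear_map sV sW s f"
  using assms by (simp add: bilinear_map_def Vector_Spaces.linear_iff)

section \<open>Separation of tensors by bilinear forms\<close>

lemma coset_eqI:
  assumes "t - u \<in> module.span formal_scale S"
  shows "coset (module.span formal_scale S) t = coset (module.span formal_scale S) u"
proof -
  interpret F: vector_space formal_scale by (fact vector_space_formal_scale)
  have "x - t \<in> F.span S \<longleftrightarrow> x - u \<in> F.span S" for x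
    using F.span_add[OF _ assms, of "x - t"] F.span_diff[OF _ assms, of "x - u"] by auto
  then show ?thesis by (simp add: coset_def)
qed

text \<open>A maximal independent subset \<open>B\<close> of \<open>S\<close> spans the same space
  and stays independent after adding \<open>t\<close>; the functional with value 1 at
  \<open>t\<close> and 0 on \<open>B\<close> extends linearly.\<close>

lemma span_separating_functional:
  assumes "vector_space s" "t \<notin> module.span s S"
  obtains g :: "'v::ab_group_add \<Rightarrow> 'k::field"
  where "Vector_Spaces.linear s (*) g" "\<And>x. x \<in> module.span s S \<Longrightarrow> g x = 0" "g t \<noteq> 0"
proof -
  interpret vector_space s by (fact assms(1))
  interpret P: vector_space_pair s "(*) :: 'k \<Rightarrow> 'k \<Rightarrow> 'k"
    by (intro vector_space_pair.intro assms(1) vector_space_mult)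
  obtain B where B: "B \<subseteq> S" "independent B" "S \<subseteq> span B"
    using maximal_independent_subset by blast
  have span: "span B = span S"
    using B by (metis span_mono span_span subset_antisym)
  then have "independent (insert t B)"
    using B(2) assms(2) by (simp add: independent_insertI)
  then obtain g where g: "Vector_Spaces.linear s (*) g"
      and eq: "\<forall>x\<in>insert t B. g x = (if x = t then 1 else 0)"
    using P.linear_independent_extend[of "insert t B" "\<lambda>x. if x = t then 1 else 0"] by blast
  have "t \<notin> B" using assms(2) span span_base by blast
  then have "g x = 0" if "x \<in> B" for x using eq that by auto
  then have "g x = 0" if "x \<in> span S" for x
    using P.linear_eq_0_on_span[OF g] that span by metis
  with g eq show thesis by (intro that[of g]) auto
qed

text \<open>If the cosets differ, the difference of their representatives lies outside the
  relations. A functional that kills the relations but not this difference gives, on pure vectors, a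
  bilinear form that tells the cosets apart.\<close>

lemma tensor_eqI:
  fixes A B :: "('v::ab_group_add \<times> 'w::ab_group_add \<Rightarrow>\<^sub>0 'k::field) set"
  assumes vs: "vector_space sV" "vector_space sW"
    and A: "A \<in> range (coset (tensor_relations sV sW))"
    and B: "B \<in> range (coset (tensor_relations sV sW))"
    and eq: "\<And>f. bilinear_map sV sW (*) f \<Longrightarrow> tensor_lift (*) f A = tensor_lift (*) f B"
  shows "A = B"
proof (rule ccontr)
  assume "A \<noteq> B"
  obtain t u where tu: "A = coset (tensor_relations sV sW) t" "B = coset (tensor_relations sV sW) u"
    using A B by auto
  have notin: "t - u \<notin> tensor_relations sV sW"
    using \<open>A \<noteq> B\<close> tu coset_eqI unfolding tensor_relations_def by blast
  then obtain g :: "('v \<times> 'w \<Rightarrow>\<^sub>0 'k) \<Rightarrow> 'k" where g: "Vector_Spaces.linear formal_scale (*) g"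
    and g0: "\<And>x. x \<in> tensor_relations sV sW \<Longrightarrow> g x = 0" and gtu: "g (t - u) \<noteq> 0"
    using span_separating_functional[OF vector_space_formal_scale
        notin[unfolded tensor_relations_def]]
    by (auto simp: tensor_relations_def)
  interpret F: vector_space formal_scale by (fact vector_space_formal_scale)
  interpret g: Vector_Spaces.linear formal_scale "(*)" g by (fact g)
  let ?f = "\<lambda>v w. g (pure (v, w))"
  have rel: "pure (v + v', w) - pure (v, w) - pure (v', w) \<in> tensor_relations sV sW"
    "pure (v, w + w') - pure (v, w) - pure (v, w') \<in> tensor_relations sV sW"
    "pure (sV k v, w) - formal_scale k (pure (v, w)) \<in> tensor_relations sV sW"
    "pure (v, sW k w) - formal_scale k (pure (v, w)) \<in> tensor_relations sV sW" for k v v' w w'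
    unfolding tensor_relations_def by (rule F.span_base; blast)+
  \<comment> \<open>Vanishing of \<open>g\<close> on the four kinds of generators is exactly
    bilinearity of \<open>?f\<close>.\<close>
  have bil: "bilinear_map sV sW (*) ?f"
    using rel[THEN g0]
    by (intro bilinear_mapI vs vector_space_mult)
      (simp_all add: g.diff g.add g.scale algebra_simps)
  have "linear_extension (*) (\<lambda>(v, w). ?f v w) x = g x" for x
    using linear_linear_extension_apply[OF g, of pure x]
    by (simp add: linear_extension_formal_pure case_prod_beta')
  then have "tensor_lift (*) ?f (coset (tensor_relations sV sW) x) = g x" for x
    by (simp add: tensor_lift_coset[OF bil])
  with eq[OF bil] gtu tu show False by (simp add: g.diff)
qed

section \<open>Trilinear maps\<close>

definition trilinear_map ::
    "('k::field \<Rightarrow> 'u::ab_group_add \<Rightarrow> 'u) \<Rightarrow> ('k \<Rightarrow> 'v::ab_group_add \<Rightarrow> 'v)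
     \<Rightarrow> ('k \<Rightarrow> 'w::ab_group_add \<Rightarrow> 'w) \<Rightarrow> ('k \<Rightarrow> 'b::ab_group_add \<Rightarrow> 'b)
     \<Rightarrow> ('u \<Rightarrow> 'v \<Rightarrow> 'w \<Rightarrow> 'b) \<Rightarrow> bool" where
  "trilinear_map sU sV sW s h \<longleftrightarrow>
     (\<forall>v w. Vector_Spaces.linear sU s (\<lambda>u. h u v w)) \<and>
     (\<forall>u w. Vector_Spaces.linear sV s (\<lambda>v. h u v w)) \<and>
     (\<forall>u v. Vector_Spaces.linear sW s (\<lambda>w. h u v w))"

text \<open>Coassociativity is an equation between cosets in a threefold tensor product; this lift
  turns it into an equation between iterated sums.\<close>

definition tensor3_lift ::
    "('k::field \<Rightarrow> 'b::ab_group_add \<Rightarrow> 'b) \<Rightarrow> ('u \<Rightarrow> 'v \<Rightarrow> 'w \<Rightarrow> 'b)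
     \<Rightarrow> ('u \<times> 'v \<times> 'w \<Rightarrow>\<^sub>0 'k) set \<Rightarrow> 'b" where
  "tensor3_lift s h A = linear_extension s (\<lambda>(u, v, w). h u v w) (representative A)"

context
  fixes sU :: "'k::field \<Rightarrow> 'u::ab_group_add \<Rightarrow> 'u"
    and sV :: "'k \<Rightarrow> 'v::ab_group_add \<Rightarrow> 'v"
    and sW :: "'k \<Rightarrow> 'w::ab_group_add \<Rightarrow> 'w"
    and s :: "'k \<Rightarrow> 'b::ab_group_add \<Rightarrow> 'b"
    and h :: "'u \<Rightarrow> 'v \<Rightarrow> 'w \<Rightarrow> 'b"
  assumes h: "trilinear_map sU sV sW s h"
begin

lemma trilinear_map_vector_space: "vector_space s"
  using h by (simp add: trilinear_map_def Vector_Spaces.linear_iff)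

lemma linear_extension_tensor3_relations:
  assumes t: "t \<in> tensor3_relations sU sV sW"
  shows "linear_extension s (\<lambda>(u, v, w). h u v w) t = 0"
proof -
  let ?L = "linear_extension s (\<lambda>(u, v, w). h u v w)"
  note vs = trilinear_map_vector_space
  interpret F: vector_space formal_scale by (fact vector_space_formal_scale)
  interpret L: Vector_Spaces.linear formal_scale s ?L by (rule linear_linear_extension[OF vs])
  show ?thesis
    using t unfolding tensor3_relations_def
  proof (induction rule: F.span_induct_alt)
    case base
    show ?case by (fact L.zero)
  next
    case (step k x y)
    have "?L x = 0"
      using step(1) h
      by (auto simp: L.diff L.scale linear_extension_pure[OF vs] trilinear_map_def
          Vector_Spaces.linear_iff)
    then show ?case using step by (simp add: L.add L.scale)
  qed
qed

lemma tensor3_lift_coset: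
  "tensor3_lift s h (coset (tensor3_relations sU sV sW) t) =
   linear_extension s (\<lambda>(u, v, w). h u v w) t"
proof -
  let ?r = "representative (coset (tensor3_relations sU sV sW) t)"
  interpret F: vector_space formal_scale by (fact vector_space_formal_scale)
  interpret L: Vector_Spaces.linear formal_scale s "linear_extension s (\<lambda>(u, v, w). h u v w)"
    by (rule linear_linear_extension[OF trilinear_map_vector_space])
  have "?r - t \<in> tensor3_relations sU sV sW"
    by (rule representative_coset_diff) (simp add: tensor3_relations_def F.span_zero)
  from linear_extension_tensor3_relations[OF this]
  show ?thesis by (simp add: tensor3_lift_def L.diff)
qed

text \<open>With the coaction or comultiplication as \<open>F\<close>, and as \<open>G\<close> in
  the mirrored rule, these are the two iterated Sweedler sums: the first component is split here,
  the second one there.\<close>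

lemma tensor3_lift_tensor_map_left:
  "tensor3_lift s h (tensor_map_left sU sV sW F g A) =
   tensor_lift s (\<lambda>a b. tensor_lift s (\<lambda>u v. h u v (g b)) (F a)) A"
  by (simp add: tensor_map_left_def tensor3_lift_coset tensor_lift_def case_prod_beta'
      linear_extension_linear_extension[OF trilinear_map_vector_space]
      linear_extension_pure[OF trilinear_map_vector_space])

lemma tensor3_lift_tensor_map_right:
  "tensor3_lift s h (tensor_map_right sU sV sW f G A) =
   tensor_lift s (\<lambda>a b. tensor_lift s (\<lambda>v w. h (f a) v w) (G b)) A"
  by (simp add: tensor_map_right_def tensor3_lift_coset tensor_lift_def case_prod_beta'
      linear_extension_linear_extension[OF trilinear_map_vector_space]
      linear_extension_pure[OF trilinear_map_vector_space])

end

section \<open>The action induced by \<open>\<sigma>\<close>\<close>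

text \<open>Gathers the data from which the action is built. The map \<open>\<beta>\<^sub>M\<close>
  does not occur in the formula of the action; its compatibility with the action is shown in the
  final proof.\<close>

locale anti_coquasitriangular_comodule =
  C: anti_coquasitriangular_infBH_bialgebra sC l \<Delta> \<epsilon> \<alpha>\<^sub>C \<beta>\<^sub>C \<psi>\<^sub>C \<omega>\<^sub>C \<sigma> +
  M: right_bihom_comodule sC \<Delta> \<psi>\<^sub>C \<omega>\<^sub>C sM \<phi> \<psi>\<^sub>M \<omega>\<^sub>M
  for sC :: "'k::field \<Rightarrow> 'c::ab_group_add \<Rightarrow> 'c"
    and sM :: "'k \<Rightarrow> 'm::ab_group_add \<Rightarrow> 'm"
    and l :: 'k
    and \<Delta> :: "'c \<Rightarrow> ('c \<times> 'c \<Rightarrow>\<^sub>0 'k) set"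
    and \<epsilon> :: "'c \<Rightarrow> 'k"
    and \<alpha>\<^sub>C \<beta>\<^sub>C \<psi>\<^sub>C \<omega>\<^sub>C :: "'c \<Rightarrow> 'c"
    and \<sigma> :: "'c \<Rightarrow> 'c \<Rightarrow> 'k"
    and \<phi> :: "'m \<Rightarrow> ('m \<times> 'c \<Rightarrow>\<^sub>0 'k) set"
    and \<psi>\<^sub>M \<omega>\<^sub>M :: "'m \<Rightarrow> 'm" +
  fixes \<alpha>\<^sub>M :: "'m \<Rightarrow> 'm"
  assumes bij_omega: "bij \<omega>\<^sub>M"
    and linear_alpha: "Vector_Spaces.linear sM sM \<alpha>\<^sub>M"
    and alpha_omega: "\<alpha>\<^sub>M \<circ> \<omega>\<^sub>M = \<omega>\<^sub>M \<circ> \<alpha>\<^sub>M"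
    and coaction_alpha: "\<phi> \<circ> \<alpha>\<^sub>M = tensor_map sM sC \<alpha>\<^sub>M \<alpha>\<^sub>C \<circ> \<phi>"
begin

sublocale vC: vector_space sC by (fact C.vector_space_scale)
sublocale vM: vector_space sM by (fact M.vector_space_scale)

abbreviation mult :: "'c \<Rightarrow> 'c \<Rightarrow> 'c" where
  "mult \<equiv> sigma_mult sC l \<Delta> \<epsilon> \<alpha>\<^sub>C \<beta>\<^sub>C \<psi>\<^sub>C \<omega>\<^sub>C \<sigma>"

definition act :: "'m \<Rightarrow> 'c \<Rightarrow> 'm" (infixl "\<triangleleft>" 70) where
  "m \<triangleleft> c = tensor_lift sM (\<lambda>m0 m1. sM (\<sigma> m1 (\<psi>\<^sub>C c)) (\<alpha>\<^sub>M (inv \<omega>\<^sub>M m0))) (\<phi> m)"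

lemmas linear_maps =
  C.linear_psi C.linear_alpha C.linear_beta
  linear_inv[OF C.linear_psi C.bij_psi] linear_inv[OF C.linear_omega C.bij_omega]
  linear_inv[OF M.linear_omega bij_omega] linear_alpha

lemma linear_map_simps:
  "\<psi>\<^sub>C (x + y) = \<psi>\<^sub>C x + \<psi>\<^sub>C y" "\<psi>\<^sub>C (sC k x) = sC k (\<psi>\<^sub>C x)"
  "\<alpha>\<^sub>C (x + y) = \<alpha>\<^sub>C x + \<alpha>\<^sub>C y" "\<alpha>\<^sub>C (sC k x) = sC k (\<alpha>\<^sub>C x)"
  "\<beta>\<^sub>C (x + y) = \<beta>\<^sub>C x + \<beta>\<^sub>C y" "\<beta>\<^sub>C (sC k x) = sC k (\<beta>\<^sub>C x)"
  "inv \<psi>\<^sub>C (x + y) = inv \<psi>\<^sub>C x + inv \<psi>\<^sub>C y" "inv \<psi>\<^sub>C (sC k x) = sC k (inv \<psi>\<^sub>C x)"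
  "inv \<omega>\<^sub>C (x + y) = inv \<omega>\<^sub>C x + inv \<omega>\<^sub>C y" "inv \<omega>\<^sub>C (sC k x) = sC k (inv \<omega>\<^sub>C x)"
  "\<alpha>\<^sub>M (m + n) = \<alpha>\<^sub>M m + \<alpha>\<^sub>M n" "\<alpha>\<^sub>M (sM k m) = sM k (\<alpha>\<^sub>M m)"
  "inv \<omega>\<^sub>M (m + n) = inv \<omega>\<^sub>M m + inv \<omega>\<^sub>M n" "inv \<omega>\<^sub>M (sM k m) = sM k (inv \<omega>\<^sub>M m)"
  "\<sigma> (x + y) z = \<sigma> x z + \<sigma> y z" "\<sigma> z (x + y) = \<sigma> z x + \<sigma> z y"
  "\<sigma> (sC k x) z = k * \<sigma> x z" "\<sigma> z (sC k x) = k * \<sigma> z x"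
  using linear_maps C.bilinear_sigma by (simp_all add: Vector_Spaces.linear_iff bilinear_map_def)

lemma inv_simps [simp]:
  "inv \<psi>\<^sub>C (\<psi>\<^sub>C x) = x" "inv \<omega>\<^sub>C (\<omega>\<^sub>C x) = x" "\<omega>\<^sub>C (inv \<omega>\<^sub>C x) = x" "\<psi>\<^sub>C (inv \<psi>\<^sub>C x) = x"
  "inv \<omega>\<^sub>M (\<omega>\<^sub>M m) = m" "\<omega>\<^sub>M (inv \<omega>\<^sub>M m) = m"
  using C.bij_psi C.bij_omega bij_omega
  by (simp_all add: bij_is_inj bij_is_surj surj_f_inv_f)

lemma sigma_simps:
  "\<sigma> (\<alpha>\<^sub>C x) (\<alpha>\<^sub>C y) = \<sigma> x y" "\<sigma> (\<beta>\<^sub>C x) (\<beta>\<^sub>C y) = \<sigma> x y"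
  "\<sigma> (\<psi>\<^sub>C x) (\<psi>\<^sub>C y) = \<sigma> x y" "\<sigma> (\<omega>\<^sub>C x) (\<omega>\<^sub>C y) = \<sigma> x y"
  by (simp_all add: C.sigma_invariant)

lemma commute_simps:
  "\<alpha>\<^sub>C (\<psi>\<^sub>C x) = \<psi>\<^sub>C (\<alpha>\<^sub>C x)" "\<alpha>\<^sub>C (\<omega>\<^sub>C x) = \<omega>\<^sub>C (\<alpha>\<^sub>C x)"
  "\<beta>\<^sub>C (\<psi>\<^sub>C x) = \<psi>\<^sub>C (\<beta>\<^sub>C x)" "\<beta>\<^sub>C (\<omega>\<^sub>C x) = \<omega>\<^sub>C (\<beta>\<^sub>C x)"
  "\<omega>\<^sub>C (\<psi>\<^sub>C x) = \<psi>\<^sub>C (\<omega>\<^sub>C x)" "\<alpha>\<^sub>M (\<omega>\<^sub>M m) = \<omega>\<^sub>M (\<alpha>\<^sub>M m)"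
  using C.alpha_psi C.alpha_omega C.beta_psi C.beta_omega C.psi_omega alpha_omega
  by (metis comp_apply)+

lemma inv_omega_alpha: "inv \<omega>\<^sub>M (\<alpha>\<^sub>M m) = \<alpha>\<^sub>M (inv \<omega>\<^sub>M m)"
  by (metis commute_simps(6) inv_simps(5,6))

section \<open>Equivariance and coassociativity under the lift\<close>

lemma tensor_lift_coaction_omega:
  assumes "bilinear_map sM sC s f"
  shows "tensor_lift s f (\<phi> (\<omega>\<^sub>M m)) = tensor_lift s (\<lambda>a b. f (\<omega>\<^sub>M a) (\<omega>\<^sub>C b)) (\<phi> m)"
proof -
  interpret vector_space s
    using assms by (simp add: bilinear_map_def Vector_Spaces.linear_iff)
  show ?thesis
    using M.coaction_omega by (metis comp_apply tensor_lift_tensor_map[OF assms])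
qed

lemma tensor_lift_coaction_alpha:
  assumes "bilinear_map sM sC s f"
  shows "tensor_lift s f (\<phi> (\<alpha>\<^sub>M m)) = tensor_lift s (\<lambda>a b. f (\<alpha>\<^sub>M a) (\<alpha>\<^sub>C b)) (\<phi> m)"
proof -
  interpret vector_space s
    using assms by (simp add: bilinear_map_def Vector_Spaces.linear_iff)
  show ?thesis
    using coaction_alpha by (metis comp_apply tensor_lift_tensor_map[OF assms])
qed

text \<open>The rule for \<open>\<omega>\<^sub>M\<close> at the point
  \<open>inv \<omega>\<^sub>M m\<close>, applied to \<open>f\<close> precomposed with both
  inverses.\<close>

lemma tensor_lift_coaction_inv_omega:
  assumes f: "bilinear_map sM sC s f"
  shows "tensor_lift s f (\<phi> (inv \<omega>\<^sub>M m)) = tensor_lift s (\<lambda>a b. f (inv \<omega>\<^sub>M a) (inv \<omega>\<^sub>C b)) (\<phi> m)"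
proof -
  have "bilinear_map sM sC s (\<lambda>a b. f (inv \<omega>\<^sub>M a) (inv \<omega>\<^sub>C b))"
    using f by (auto simp: bilinear_map_def Vector_Spaces.linear_iff linear_map_simps)
  from tensor_lift_coaction_omega[OF this, of "inv \<omega>\<^sub>M m"] show ?thesis by simp
qed

lemma tensor_lift_comult_psi:
  assumes "bilinear_map sC sC s f"
  shows "tensor_lift s f (\<Delta> (\<psi>\<^sub>C c)) = tensor_lift s (\<lambda>a b. f (\<psi>\<^sub>C a) (\<psi>\<^sub>C b)) (\<Delta> c)"
proof -
  interpret vector_space s
    using assms by (simp add: bilinear_map_def Vector_Spaces.linear_iff)
  show ?thesis
    using C.comult_psi by (metis comp_apply tensor_lift_tensor_map[OF assms])
qed

lemma coassociative_lift:
  assumes "trilinear_map sM sC sC s h"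
  shows "tensor_lift s (\<lambda>a b. tensor_lift s (\<lambda>u v. h u v (\<psi>\<^sub>C b)) (\<phi> a)) (\<phi> m) =
    tensor_lift s (\<lambda>a b. tensor_lift s (\<lambda>v w. h (\<omega>\<^sub>M a) v w) (\<Delta> b)) (\<phi> m)"
  using M.coaction_coassociative
  by (metis comp_apply tensor3_lift_tensor_map_left[OF assms] tensor3_lift_tensor_map_right[OF assms])

section \<open>Bilinearity of the action and its compatibility with \<alpha>\<close>

lemma bilinear_act_integrand:
  "bilinear_map sM sC sM (\<lambda>m0 m1. sM (\<sigma> m1 c) (\<alpha>\<^sub>M (inv \<omega>\<^sub>M m0)))"
  by (rule bilinear_mapI)
    (simp_all add: linear_map_simps vC.vector_space_axioms vM.vector_space_axioms
      vM.scale_right_distrib vM.scale_left_distrib mult.commute)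

lemma bilinear_act: "bilinear_map sM sC sM (\<triangleleft>)"
  unfolding bilinear_map_def
proof (intro conjI allI)
  \<comment> \<open>Here the sum runs over one fixed \<open>\<phi> m\<close>, so linearity holds
    term by term.\<close>
  show "Vector_Spaces.linear sC sM ((\<triangleleft>) m)" for m
    by (simp add: Vector_Spaces.linear_iff vC.vector_space_axioms vM.vector_space_axioms act_def
        linear_map_simps vM.scale_left_distrib vM.tensor_lift_add vM.tensor_lift_scale
        flip: vM.scale_scale)
  \<comment> \<open>Here \<open>\<phi> m\<close> itself varies, so linearity of the coaction and
    bilinearity of the integrand come in.\<close>
  show "Vector_Spaces.linear sM sM (\<lambda>m. m \<triangleleft> c)" for c
    unfolding act_def
    by (rule vM.linear_tensor_lift_into_quotient[OF vM.vector_space_axioms M.linear_coaction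
          bilinear_act_integrand])
qed

lemma act_alpha:
  "\<alpha>\<^sub>M m \<triangleleft> c = tensor_lift sM
    (\<lambda>m0 m1. sM (\<sigma> (\<alpha>\<^sub>C m1) (\<psi>\<^sub>C c)) (\<alpha>\<^sub>M (\<alpha>\<^sub>M (inv \<omega>\<^sub>M m0)))) (\<phi> m)"
  by (simp add: act_def tensor_lift_coaction_alpha[OF bilinear_act_integrand] inv_omega_alpha)

lemma act_omega: "\<omega>\<^sub>M m \<triangleleft> c = tensor_lift sM (\<lambda>m0 m1. sM (\<sigma> (\<omega>\<^sub>C m1) (\<psi>\<^sub>C c)) (\<alpha>\<^sub>M m0)) (\<phi> m)"
  by (simp add: act_def tensor_lift_coaction_omega[OF bilinear_act_integrand])

lemma alpha_act: "\<alpha>\<^sub>M (m \<triangleleft> c) = \<alpha>\<^sub>M m \<triangleleft> \<alpha>\<^sub>C c"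
  unfolding act_alpha
  \<comment> \<open>The reversed commutation rules move \<open>\<alpha>\<^sub>C\<close> outside
    \<open>\<psi>\<^sub>C\<close>, where invariance of \<sigma> removes it.\<close>
  by (simp add: act_def linear_tensor_lift[OF linear_alpha] linear_map_simps sigma_simps
      flip: commute_simps)

text \<open>The coaction commutes with \<open>\<alpha>\<^sub>M\<close> and
  \<open>inv \<omega>\<^sub>M\<close>, which splits the module component \<open>m0\<close>;
  coassociativity then moves the splitting to \<open>m1\<close>. Both the module law and the Hopf
  compatibility start from this formula.\<close>

lemma tensor_lift_coaction_act:
  assumes f: "bilinear_map sM sC s f"
  shows "tensor_lift s f (\<phi> (m \<triangleleft> c)) =
    tensor_lift s (\<lambda>m0 m1. tensor_lift s
      (\<lambda>c1 c2. s (\<sigma> c2 (\<psi>\<^sub>C (\<psi>\<^sub>C c))) (f (\<alpha>\<^sub>M m0) (\<alpha>\<^sub>C (inv \<omega>\<^sub>C c1)))) (\<Delta> m1)) (\<phi> m)"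
proof -
  interpret vector_space s
    using f by (simp add: bilinear_map_def Vector_Spaces.linear_iff)
  \<comment> \<open>Coassociativity expects its third argument as \<open>\<psi>\<^sub>C m1\<close>.
    Invariance of \<sigma> inserts this \<psi>, which accounts for the second \<psi> on
    \<open>c\<close>.\<close>
  let ?h = "\<lambda>a b d. s (\<sigma> d (\<psi>\<^sub>C (\<psi>\<^sub>C c))) (f (\<alpha>\<^sub>M (inv \<omega>\<^sub>M a)) (\<alpha>\<^sub>C (inv \<omega>\<^sub>C b)))"
  have f_alpha: "bilinear_map sM sC s (\<lambda>a b. f (\<alpha>\<^sub>M a) (\<alpha>\<^sub>C b))"
    using f by (simp add: bilinear_map_def Vector_Spaces.linear_iff linear_map_simps)
  have h: "trilinear_map sM sC sC s ?h"
    using f by (simp add: trilinear_map_def bilinear_map_def Vector_Spaces.linear_iff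
        linear_map_simps scale_left_distrib scale_right_distrib scale_left_commute)
  note lin = linear_tensor_lift_into_quotient[OF vM.vector_space_axioms M.linear_coaction f]
  have "tensor_lift s f (\<phi> (m \<triangleleft> c)) =
      tensor_lift s (\<lambda>m0 m1. tensor_lift s f (\<phi> (sM (\<sigma> m1 (\<psi>\<^sub>C c)) (\<alpha>\<^sub>M (inv \<omega>\<^sub>M m0))))) (\<phi> m)"
    unfolding act_def by (rule linear_tensor_lift[OF lin])
  also have "\<dots> = tensor_lift s (\<lambda>m0 m1. tensor_lift s (\<lambda>u v. ?h u v (\<psi>\<^sub>C m1)) (\<phi> m0)) (\<phi> m)"
    using lin
    by (simp add: Vector_Spaces.linear_iff tensor_lift_coaction_alpha[OF f]
        tensor_lift_coaction_inv_omega[OF f_alpha] tensor_lift_scale sigma_simps)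
  also have "\<dots> = tensor_lift s (\<lambda>m0 m1. tensor_lift s (\<lambda>v w. ?h (\<omega>\<^sub>M m0) v w) (\<Delta> m1)) (\<phi> m)"
    by (rule coassociative_lift[OF h])
  finally show ?thesis by simp
qed

lemma linear_mult:
  assumes L: "Vector_Spaces.linear sC s L"
  shows "L (mult c d) =
    tensor_lift s (\<lambda>c1 c2. s (\<sigma> c2 (\<psi>\<^sub>C d)) (L (\<alpha>\<^sub>C (inv \<omega>\<^sub>C c1)))) (\<Delta> c)
    - tensor_lift s (\<lambda>d1 d2. s (\<sigma> (\<omega>\<^sub>C c) d1) (L (\<beta>\<^sub>C (inv \<psi>\<^sub>C d2)))) (\<Delta> d)
    - s (l * \<epsilon> c) (L (\<beta>\<^sub>C d))"
proof -
  interpret L: Vector_Spaces.linear sC s L by (fact L)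
  show ?thesis
    by (simp add: sigma_mult_def L.diff L.scale linear_tensor_lift[OF L])
qed

text \<open>After expanding the product, invariance of \<sigma> produces all terms of the
  anti-coquasitriangular identity at \<open>x\<close>, \<open>c\<close>, \<open>d\<close> except its
  first one, and the identity equates them with that term.\<close>

lemma sigma_alpha_mult:
  "\<sigma> (\<alpha>\<^sub>C x) (mult c d) =
   tensor_lift (*) (\<lambda>x1 x2. \<sigma> (\<alpha>\<^sub>C x1) (\<beta>\<^sub>C (\<omega>\<^sub>C d)) * \<sigma> x2 (\<psi>\<^sub>C c)) (\<Delta> x)"
proof -
  have lin: "Vector_Spaces.linear sC (*) (\<sigma> (\<alpha>\<^sub>C x))"
    using C.bilinear_sigma by (simp add: bilinear_map_def)
  \<comment> \<open>In \<open>1\<close> and \<open>2\<close>, invariance under \<omega> and \<psi>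
    trades the inverse in the second argument for the map itself in the first.\<close>
  have 1: "\<sigma> (\<alpha>\<^sub>C x) (\<alpha>\<^sub>C (inv \<omega>\<^sub>C y)) = \<sigma> (\<omega>\<^sub>C x) y" for y
    by (metis sigma_simps(1,4) inv_simps(3))
  have 2: "\<sigma> (\<alpha>\<^sub>C x) (\<beta>\<^sub>C (inv \<psi>\<^sub>C y)) = \<sigma> (\<alpha>\<^sub>C (\<psi>\<^sub>C x)) (\<beta>\<^sub>C y)" for y
    by (metis sigma_simps(3) commute_simps(1,3) inv_simps(4))
  have "\<sigma> (\<alpha>\<^sub>C x) (mult c d) =
      tensor_lift (*) (\<lambda>c1 c2. \<sigma> (\<omega>\<^sub>C x) c1 * \<sigma> c2 (\<psi>\<^sub>C d)) (\<Delta> c)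
      - tensor_lift (*) (\<lambda>d1 d2. \<sigma> (\<omega>\<^sub>C c) d1 * \<sigma> (\<alpha>\<^sub>C (\<psi>\<^sub>C x)) (\<beta>\<^sub>C d2)) (\<Delta> d)
      - l * \<epsilon> c * \<sigma> (\<alpha>\<^sub>C x) (\<beta>\<^sub>C d)"
    unfolding linear_mult[OF lin] 1 2 by (simp only: mult.commute)
  then show ?thesis
    using C.anti_coquasitriangular[where c = x and d = c and e = d] by algebra
qed

lemma act_mult: "\<alpha>\<^sub>M m \<triangleleft> mult c d = m \<triangleleft> c \<triangleleft> \<beta>\<^sub>C d"
proof -
  have *: "\<sigma> (\<alpha>\<^sub>C (inv \<omega>\<^sub>C y)) (\<psi>\<^sub>C (\<beta>\<^sub>C d)) = \<sigma> (\<alpha>\<^sub>C y) (\<beta>\<^sub>C (\<omega>\<^sub>C (\<psi>\<^sub>C d)))" for y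
    by (metis sigma_simps(4) commute_simps(2-5) inv_simps(3))
  have "m \<triangleleft> c \<triangleleft> \<beta>\<^sub>C d = tensor_lift sM (\<lambda>m0 m1. tensor_lift sM
      (\<lambda>c1 c2. sM (\<sigma> c2 (\<psi>\<^sub>C (\<psi>\<^sub>C c))) (sM (\<sigma> (\<alpha>\<^sub>C (inv \<omega>\<^sub>C c1)) (\<psi>\<^sub>C (\<beta>\<^sub>C d)))
        (\<alpha>\<^sub>M (inv \<omega>\<^sub>M (\<alpha>\<^sub>M m0))))) (\<Delta> m1)) (\<phi> m)"
    unfolding act_def[of "m \<triangleleft> c"] by (rule tensor_lift_coaction_act[OF bilinear_act_integrand])
  \<comment> \<open>By \<open>sigma_alpha_mult\<close>, the inner sum over
    \<open>\<Delta> m1\<close> is a single value of \<sigma> on the product of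
    \<open>\<psi>\<^sub>C c\<close> and \<open>\<psi>\<^sub>C d\<close>; multiplicativity of \<psi>
    finally makes this \<open>\<psi>\<^sub>C (mult c d)\<close>.\<close>
  also have "\<dots> = tensor_lift sM
      (\<lambda>m0 m1. sM (\<sigma> (\<alpha>\<^sub>C m1) (mult (\<psi>\<^sub>C c) (\<psi>\<^sub>C d))) (\<alpha>\<^sub>M (\<alpha>\<^sub>M (inv \<omega>\<^sub>M m0)))) (\<phi> m)"
    by (simp add: * sigma_alpha_mult inv_omega_alpha vM.tensor_lift_scale_left mult.commute)
  finally show ?thesis by (simp add: act_alpha C.psi_mult)
qed

text \<open>Tested against a bilinear form \<open>f\<close>. The counit condition compares two terms
  with the factor \<open>l\<close>, hence the guard \<open>l \<noteq> 0\<close>.\<close>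

lemma coaction_act:
  assumes counitary: "l \<noteq> 0 \<Longrightarrow> tensor_lift sM (\<lambda>m0 m1. sM (\<epsilon> m1) m0) (\<phi> m) = \<omega>\<^sub>M m"
  shows "\<phi> (m \<triangleleft> c) =
    quotient_add (tensor_relations sM sC)
      (quotient_add (tensor_relations sM sC)
        (tensor_map sM sC (\<lambda>c1. \<omega>\<^sub>M m \<triangleleft> c1) \<beta>\<^sub>C (\<Delta> c))
        (tensor_map sM sC \<alpha>\<^sub>M (\<lambda>m1. mult m1 (\<psi>\<^sub>C c)) (\<phi> m)))
      (quotient_scale (tensor_relations sM sC) l (tensor sM sC (\<alpha>\<^sub>M (\<omega>\<^sub>M m)) (\<beta>\<^sub>C (\<psi>\<^sub>C c))))"
    (is "_ = ?R")
proof (rule tensor_eqI[OF vM.vector_space_axioms vC.vector_space_axioms])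
  show "\<phi> (m \<triangleleft> c) \<in> range (coset (tensor_relations sM sC))"
    using M.linear_coaction by (simp add: linear_into_quotient_def)
  show "?R \<in> range (coset (tensor_relations sM sC))"
    by (simp add: quotient_add_def)
  fix f :: "'m \<Rightarrow> 'c \<Rightarrow> 'k"
  assume f: "bilinear_map sM sC (*) f"
  note lift_simps = vector_space.tensor_lift_diff[OF vector_space_mult]
    vector_space.tensor_lift_quotient_add[OF vector_space_mult f]
    vector_space.tensor_lift_quotient_scale[OF vector_space_mult f]
    vector_space.tensor_lift_tensor_map[OF vector_space_mult f] tensor_lift_tensor[OF f]
  have lin1: "Vector_Spaces.linear sM (*) (\<lambda>a. f a y)" for y
    using f by (simp add: bilinear_map_def)
  have lin2: "Vector_Spaces.linear sC (*) (f x)" for x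
    using f by (simp add: bilinear_map_def)
  have f_scale: "f (sM k a) y = k * f a y" for k a y
    using lin1 by (simp add: Vector_Spaces.linear_iff)
  \<comment> \<open>The common value of the two terms that cancel: the action on
    \<open>\<Delta> c\<close> and the middle term of the product.\<close>
  let ?Q = "tensor_lift (*) (\<lambda>m0 m1. tensor_lift (*)
      (\<lambda>c1 c2. \<sigma> (\<omega>\<^sub>C m1) (\<psi>\<^sub>C c1) * f (\<alpha>\<^sub>M m0) (\<beta>\<^sub>C c2)) (\<Delta> c)) (\<phi> m)"
  \<comment> \<open>Acting on \<open>\<omega>\<^sub>M m\<close> cancels the inverse in the action;
    the sums over \<open>\<phi> m\<close> and \<open>\<Delta> c\<close> are then exchanged.\<close>
  have 1: "tensor_lift (*) (\<lambda>c1 c2. f (\<omega>\<^sub>M m \<triangleleft> c1) (\<beta>\<^sub>C c2)) (\<Delta> c) = ?Q"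
    unfolding act_omega linear_tensor_lift[OF lin1] f_scale
    by (rule vector_space.tensor_lift_swap[OF vector_space_mult])
  \<comment> \<open>Needed in \<open>2\<close> to pass from
    \<open>\<Delta> (\<psi>\<^sub>C c)\<close> to \<open>\<Delta> c\<close>, which cancels
    \<open>inv \<psi>\<^sub>C\<close> in the middle term of the product.\<close>
  have bil: "bilinear_map sC sC (*) (\<lambda>d1 d2. \<sigma> y d1 * f x (\<beta>\<^sub>C (inv \<psi>\<^sub>C d2)))" for x y
    using lin2
    by (intro bilinear_mapI vC.vector_space_axioms vector_space_mult)
      (simp_all add: Vector_Spaces.linear_iff linear_map_simps distrib_left distrib_right
        mult.left_commute)
  have 2: "f (\<alpha>\<^sub>M m0) (mult m1 (\<psi>\<^sub>C c)) =
      tensor_lift (*) (\<lambda>c1 c2. \<sigma> c2 (\<psi>\<^sub>C (\<psi>\<^sub>C c)) * f (\<alpha>\<^sub>M m0) (\<alpha>\<^sub>C (inv \<omega>\<^sub>C c1))) (\<Delta> m1)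
      - tensor_lift (*) (\<lambda>c1 c2. \<sigma> (\<omega>\<^sub>C m1) (\<psi>\<^sub>C c1) * f (\<alpha>\<^sub>M m0) (\<beta>\<^sub>C c2)) (\<Delta> c)
      - l * (\<epsilon> m1 * f (\<alpha>\<^sub>M m0) (\<beta>\<^sub>C (\<psi>\<^sub>C c)))" for m0 m1
    by (simp add: linear_mult[OF lin2] tensor_lift_comult_psi[OF bil] mult.assoc)
  have 3: "l * tensor_lift (*) (\<lambda>m0 m1. \<epsilon> m1 * f (\<alpha>\<^sub>M m0) (\<beta>\<^sub>C (\<psi>\<^sub>C c))) (\<phi> m) =
      l * f (\<alpha>\<^sub>M (\<omega>\<^sub>M m)) (\<beta>\<^sub>C (\<psi>\<^sub>C c))"
  proof (cases "l = 0")
    case False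
    show ?thesis
      by (simp add: counitary[OF False, symmetric] linear_tensor_lift[OF linear_alpha]
          linear_tensor_lift[OF lin1] linear_map_simps f_scale)
  qed simp
  show "tensor_lift (*) f (\<phi> (m \<triangleleft> c)) = tensor_lift (*) f ?R"
    \<comment> \<open>The first sum in \<open>2\<close> is the lift of
      \<open>\<phi> (m \<triangleleft> c)\<close>, \<open>?Q\<close> occurs with both signs, and
      \<open>3\<close> cancels the \<lambda>-terms.\<close>
    by (simp add: tensor_lift_coaction_act[OF f] lift_simps 1 2 3
        vector_space.tensor_lift_scale[OF vector_space_mult])
qed

end

theorem theorem2p56:
  fixes sC :: "'k::field \<Rightarrow> 'c::ab_group_add \<Rightarrow> 'c"
    and sM :: "'k \<Rightarrow> 'm::ab_group_add \<Rightarrow> 'm"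
    and l :: 'k
    and \<Delta> :: "'c \<Rightarrow> ('c \<times> 'c \<Rightarrow>\<^sub>0 'k) set"
    and \<epsilon> :: "'c \<Rightarrow> 'k"
    and \<alpha>\<^sub>C \<beta>\<^sub>C \<psi>\<^sub>C \<omega>\<^sub>C :: "'c \<Rightarrow> 'c"
    and \<sigma> :: "'c \<Rightarrow> 'c \<Rightarrow> 'k"
    and \<phi> :: "'m \<Rightarrow> ('m \<times> 'c \<Rightarrow>\<^sub>0 'k) set"
    and \<alpha>\<^sub>M \<beta>\<^sub>M \<psi>\<^sub>M \<omega>\<^sub>M :: "'m \<Rightarrow> 'm"
  assumes C: "anti_coquasitriangular_infBH_bialgebra sC l \<Delta> \<epsilon> \<alpha>\<^sub>C \<beta>\<^sub>C \<psi>\<^sub>C \<omega>\<^sub>C \<sigma>"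
    and M: "right_bihom_comodule sC \<Delta> \<psi>\<^sub>C \<omega>\<^sub>C sM \<phi> \<psi>\<^sub>M \<omega>\<^sub>M"
    and bij_omega: "bij \<omega>\<^sub>M"
    and linear_alpha: "Vector_Spaces.linear sM sM \<alpha>\<^sub>M"
    and linear_beta: "Vector_Spaces.linear sM sM \<beta>\<^sub>M"
    and alpha_omega: "\<alpha>\<^sub>M \<circ> \<omega>\<^sub>M = \<omega>\<^sub>M \<circ> \<alpha>\<^sub>M"
    and coaction_alpha: "\<phi> \<circ> \<alpha>\<^sub>M = tensor_map sM sC \<alpha>\<^sub>M \<alpha>\<^sub>C \<circ> \<phi>"
    \<comment> \<open>The remaining assumptions are tacit in the source; without them the claim is false.\<close>
    and alpha_psi: "\<alpha>\<^sub>M \<circ> \<psi>\<^sub>M = \<psi>\<^sub>M \<circ> \<alpha>\<^sub>M"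
    and alpha_beta: "\<alpha>\<^sub>M \<circ> \<beta>\<^sub>M = \<beta>\<^sub>M \<circ> \<alpha>\<^sub>M"
    and beta_psi: "\<beta>\<^sub>M \<circ> \<psi>\<^sub>M = \<psi>\<^sub>M \<circ> \<beta>\<^sub>M"
    and beta_omega: "\<beta>\<^sub>M \<circ> \<omega>\<^sub>M = \<omega>\<^sub>M \<circ> \<beta>\<^sub>M"
    and coaction_beta: "\<phi> \<circ> \<beta>\<^sub>M = tensor_map sM sC \<beta>\<^sub>M \<beta>\<^sub>C \<circ> \<phi>"
    and counitary: "l \<noteq> 0 \<Longrightarrow> \<forall>m. tensor_lift sM (\<lambda>m0 m1. sM (\<epsilon> m1) m0) (\<phi> m) = \<omega>\<^sub>M m"
  shows "right_infBH_hopf_module sC l (sigma_mult sC l \<Delta> \<epsilon> \<alpha>\<^sub>C \<beta>\<^sub>C \<psi>\<^sub>C \<omega>\<^sub>C \<sigma>)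
           \<Delta> \<alpha>\<^sub>C \<beta>\<^sub>C \<psi>\<^sub>C \<omega>\<^sub>C sM
           (\<lambda>m c. tensor_lift sM (\<lambda>m0 m1. sM (\<sigma> m1 (\<psi>\<^sub>C c)) (\<alpha>\<^sub>M (inv \<omega>\<^sub>M m0))) (\<phi> m))
           \<phi> \<alpha>\<^sub>M \<beta>\<^sub>M \<psi>\<^sub>M \<omega>\<^sub>M"
proof -
  interpret anti_coquasitriangular_comodule sC sM l \<Delta> \<epsilon> \<alpha>\<^sub>C \<beta>\<^sub>C \<psi>\<^sub>C \<omega>\<^sub>C \<sigma> \<phi> \<psi>\<^sub>M \<omega>\<^sub>M \<alpha>\<^sub>M
    using assms
    by (intro anti_coquasitriangular_comodule.intro anti_coquasitriangular_comodule_axioms.intro)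
  have beta_simps: "\<beta>\<^sub>M (\<alpha>\<^sub>M m) = \<alpha>\<^sub>M (\<beta>\<^sub>M m)" "inv \<omega>\<^sub>M (\<beta>\<^sub>M m) = \<beta>\<^sub>M (inv \<omega>\<^sub>M m)"
    "\<beta>\<^sub>M (sM k m) = sM k (\<beta>\<^sub>M m)" for k m
    using alpha_beta beta_omega linear_beta inv_simps(5,6)
    by (metis comp_apply, metis comp_apply, simp add: Vector_Spaces.linear_iff)
  \<comment> \<open>The argument for \<open>\<alpha>\<^sub>M\<close> is repeated: equivariance of
    the coaction under \<open>\<beta>\<^sub>M\<close>, its commutation with
    \<open>\<alpha>\<^sub>M\<close> and \<open>inv \<omega>\<^sub>M\<close>, and invariance of
    \<sigma> under \<open>\<beta>\<^sub>C\<close>.\<close>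
  have "tensor_lift sM f (\<phi> (\<beta>\<^sub>M m)) = tensor_lift sM (\<lambda>a b. f (\<beta>\<^sub>M a) (\<beta>\<^sub>C b)) (\<phi> m)"
    if "bilinear_map sM sC sM f" for f m
    using coaction_beta by (metis comp_apply vM.tensor_lift_tensor_map[OF that])
  from this[OF bilinear_act_integrand] have beta_act: "\<beta>\<^sub>M (m \<triangleleft> c) = \<beta>\<^sub>M m \<triangleleft> \<beta>\<^sub>C c" for m c
    by (simp add: act_def linear_tensor_lift[OF linear_beta] beta_simps sigma_simps
        flip: commute_simps)
  have "right_infBH_hopf_module sC l mult \<Delta> \<alpha>\<^sub>C \<beta>\<^sub>C \<psi>\<^sub>C \<omega>\<^sub>C sM (\<triangleleft>) \<phi> \<alpha>\<^sub>M \<beta>\<^sub>M \<psi>\<^sub>M \<omega>\<^sub>M"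
  proof (intro right_infBH_hopf_module.intro right_infBH_hopf_module_axioms.intro
      right_bihom_module.intro)
    show "f \<circ> g = g \<circ> f" if "f \<in> {\<alpha>\<^sub>M, \<beta>\<^sub>M, \<psi>\<^sub>M, \<omega>\<^sub>M}" "g \<in> {\<alpha>\<^sub>M, \<beta>\<^sub>M, \<psi>\<^sub>M, \<omega>\<^sub>M}" for f g
      using that alpha_beta alpha_psi alpha_omega beta_psi beta_omega M.psi_omega by auto
  qed (use counitary in \<open>simp_all add: vM.vector_space_axioms bilinear_act linear_alpha linear_beta
      alpha_beta alpha_act beta_act act_mult M coaction_act\<close>)
  then show ?thesis by (simp add: act_def[abs_def])
qed

end
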